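(* Let $\mathscr{T}\in\mathbb{R}^{n_1\times n_2\times n_3}$ be a third-order tensor in the tensor train (TTD) format with core tensors $\mathscr{G}_1\in\mathbb{R}^{1\times n_1\times r_1}$, $\mathscr{G}_2\in\mathbb{R}^{r_1\times n_2\times r_2}$, and $\mathscr{G}_3\in\mathbb{R}^{r_2\times n_3\times 1}$. Then the diagonal block matrices of $\mathscr{T}$ in the Fourier domain are computed as $$\mathbf{T}_{j_3}(j_1,j_2)=\sum_{\alpha_1=1}^{r_1}\sum_{\alpha_2=1}^{r_2}\mathscr{G}_1(j_1,\alpha_1)\,\mathscr{G}_2(\alpha_1,j_2,\alpha_2)\,\widetilde{\mathscr{G}}_3(\alpha_2,j_3),$$ where $\widetilde{\mathscr{G}}_3=\mathscr{G}_3\times_2\mathbf{F}_{n_3}$, for $j_3=1,2,\dots,n_3$.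
   Context: $\mathscr{T}$ is in TTD format with cores $\mathscr{G}_1,\mathscr{G}_2,\mathscr{G}_3$ if $\mathscr{T}(j_1,j_2,j_3)=\sum_{\alpha_1=1}^{r_1}\sum_{\alpha_2=1}^{r_2}\mathscr{G}_1(1,j_1,\alpha_1)\mathscr{G}_2(\alpha_1,j_2,\alpha_2)\mathscr{G}_3(\alpha_2,j_3,1)$ for all indices. Singleton indices are suppressed in the claim: $\mathscr{G}_1(j_1,\alpha_1)$ means $\mathscr{G}_1(1,j_1,\alpha_1)$ and $\widetilde{\mathscr{G}}_3(\alpha_2,j_3)$ means $\widetilde{\mathscr{G}}_3(\alpha_2,j_3,1)$. Mode-$2$ multiplication: $(\mathscr{G}\times_2\mathbf{A})(a,i,b)=\sum_j\mathbf{A}(i,j)\mathscr{G}(a,j,b)$. $\mathbf{F}_{n}\in\mathbb{C}^{n\times n}$ is the discrete Fourier transform matrix $\mathbf{F}_n(p,q)=\frac{1}{\sqrt{n}}\,\omega^{(p-1)(q-1)}$, $\omega=\exp(-2\pi i/n)$; ${}^*$ is the conjugate transpose and $\otimes$ the Kronecker product. $\texttt{bcirc}(\mathscr{T})\in\mathbb{R}^{n_1n_3\times n_2n_3}$ is the block-circulant matrix whose $(p,q)$ block ($p,q=1,\dots,n_3$) is the frontal slice $\mathscr{T}(:,:,((p-q)\bmod n_3)+1)$. The diagonal block matrices $\mathbf{T}_1,\dots,\mathbf{T}_{n_3}\in\mathbb{C}^{n_1\times n_2}$ of $\mathscr{T}$ in the Fourier domain are defined by $(\mathbf{F}_{n_3}\otimes\mathbf{I}_{n_1})\,\texttt{bcirc}(\mathscr{T})\,(\mathbf{F}_{n_3}^{*}\otimes\mathbf{I}_{n_2})=\texttt{blkdiag}(\mathbf{T}_1,\mathbf{T}_2,\dots,\mathbf{T}_{n_3})$,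 the block diagonal matrix with these blocks.
   Formalization: The right-hand side is multiplied by the square root of n_3: with the unitary F_{n_3} the printed formula is off by this factor (all sizes and ranks 1 except n_3=2, all core entries 1: T_1=2, but the printed sum is the square root of 2). *)

theory Defs
  imports
    "HOL-Analysis.Analysis"
    "Jordan_Normal_Form.Schur_Decomposition"
begin

text \<open>All indices are zero-based, as usual for Jordan_Normal_Form matrices. A third-order tensor
  is its entry function; its dimensions are passed explicitly, and entries outside of them
  are never inspected.\<close>

type_synonym 'a tensor3 = "nat \<Rightarrow> nat \<Rightarrow> nat \<Rightarrow> 'a"

definition is_ttd ::
  "nat \<Rightarrow> nat \<Rightarrow> nat \<Rightarrow> nat \<Rightarrow> nat \<Rightarrow> real tensor3 \<Rightarrow> real tensor3 \<Rightarrow> real tensor3 \<Rightarrow> real tensor3 \<Rightarrow> bool"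
where
  "is_ttd n1 n2 n3 r1 r2 T G1 G2 G3 \<longleftrightarrow>
     (\<forall>j1<n1. \<forall>j2<n2. \<forall>j3<n3.
        T j1 j2 j3 = (\<Sum>\<alpha>1<r1. \<Sum>\<alpha>2<r2. G1 0 j1 \<alpha>1 * G2 \<alpha>1 j2 \<alpha>2 * G3 \<alpha>2 j3 0))"

definition mode2_prod :: "'a::comm_semiring_0 tensor3 \<Rightarrow> 'a mat \<Rightarrow> 'a tensor3" (infixl "\<times>\<^sub>2" 70)
where
  "G \<times>\<^sub>2 A = (\<lambda>a i b. \<Sum>j<dim_col A. A $$ (i, j) * G a j b)"

definition complex_tensor :: "real tensor3 \<Rightarrow> complex tensor3" where
  "complex_tensor G = (\<lambda>a j b. complex_of_real (G a j b))"

text \<open>The unitary DFT matrix. Conjugating a circulant matrix by a unitary DFT matrix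
  diagonalizes it, but the diagonal is the \<^emph>\<open>unnormalized\<close> transform of the first column, that is
  \<^term>\<open>sqrt n\<close> times the image of the first column under this matrix; hence the factor \<^term>\<open>sqrt n\<close> in any formula
  for the diagonal blocks in terms of \<open>dft_mat\<close>.\<close>

definition dft_mat :: "nat \<Rightarrow> complex mat" where
  "dft_mat n = mat n n (\<lambda>(p, q).
     1 / complex_of_real (sqrt (real n)) * exp (- (2 * of_real pi * \<i>) / of_nat n) ^ (p * q))"

definition kronecker :: "'a::times mat \<Rightarrow> 'a mat \<Rightarrow> 'a mat" (infixl "\<otimes>\<^sub>K" 70) where
  "A \<otimes>\<^sub>K B = mat (dim_row A * dim_row B) (dim_col A * dim_col B)
     (\<lambda>(i, j). A $$ (i div dim_row B, j div dim_col B) * B $$ (i mod dim_row B, j mod dim_col B))"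

text \<open>The block index \<open>p - q\<close> is reduced modulo \<open>n3\<close> in the integers, since natural number
  subtraction truncates.\<close>

definition bcirc :: "nat \<Rightarrow> nat \<Rightarrow> nat \<Rightarrow> 'a tensor3 \<Rightarrow> 'a mat" where
  "bcirc n1 n2 n3 T = mat (n1 * n3) (n2 * n3)
     (\<lambda>(i, j). T (i mod n1) (j mod n2) (nat ((int (i div n1) - int (j div n2)) mod int n3)))"

definition is_fourier_blocks ::
  "nat \<Rightarrow> nat \<Rightarrow> nat \<Rightarrow> real tensor3 \<Rightarrow> complex mat list \<Rightarrow> bool"
where
  "is_fourier_blocks n1 n2 n3 T Ts \<longleftrightarrow>
     length Ts = n3 \<and> set Ts \<subseteq> carrier_mat n1 n2 \<and>
     (dft_mat n3 \<otimes>\<^sub>K 1\<^sub>m n1) * map_mat complex_of_real (bcirc n1 n2 n3 T)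
       * (mat_adjoint (dft_mat n3) \<otimes>\<^sub>K 1\<^sub>m n2) = diag_block_mat Ts"

definition fourier_blocks :: "nat \<Rightarrow> nat \<Rightarrow> nat \<Rightarrow> real tensor3 \<Rightarrow> complex mat list" where
  "fourier_blocks n1 n2 n3 T = (THE Ts. is_fourier_blocks n1 n2 n3 T Ts)"

end

theory Submission
  imports Defs
begin

text \<open>A block circulant matrix is diagonalized by the discrete Fourier transform for the following
  reason. The Kronecker factors \<open>F \<otimes> I\<close> and \<open>F\<^sup>* \<otimes> I\<close> leave the position \<open>(i, j)\<close> inside a block
  alone and mix only the block indices (\<open>kronecker_one_sandwich_index\<close>), so that for each fixed
  \<open>(i, j)\<close> one faces the scalar problem of conjugating by \<open>F\<close> the circulant matrix with
  entries \<open>T i j ((a - b) mod n)\<close>. Multiplying by row \<open>p\<close> of \<open>F\<close>, whose entries are proportional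
  to \<open>\<omega>\<^sup>p\<^sup>a\<close> for a root of unity \<open>\<omega>\<close>, turns the cyclic shift by \<open>b\<close> into the factor \<open>\<omega>\<^sup>p\<^sup>b\<close>
  (\<open>sum_cyclic_shift\<close>). What remains is the unnormalized transform of the
  tube \<open>T i j\<close> times the inner product of the rows \<open>p\<close> and \<open>q\<close> of \<open>F\<close>, which is \<open>1\<close> for
  \<open>p = q\<close> and \<open>0\<close> otherwise (\<open>dft_rows_orthogonal\<close>).

  Hence the conjugated matrix is block diagonal, and entry \<open>(i, j)\<close> of its \<open>k\<close>-th block is
  \<open>\<Sum>l. \<omega>\<^sup>k\<^sup>l * T i j l\<close>. A list of equally sized blocks can be read off from its block diagonal matrix
  (\<open>diag_block_mat_index\<close>), so these are the Fourier blocks. This transform acts on the third index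
  only, which in the tensor train format occurs only in the third core; by linearity it
  can be moved onto that core. The transform here is unnormalized while \<^const>\<open>dft_mat\<close> is unitary,
  whence the factor \<open>sqrt n3\<close>.\<close>


section \<open>Matrices made of blocks\<close>

lemma block_index_less:
  fixes p i m n :: nat
  assumes "p < n" "i < m"
  shows "p * m + i < n * m"
proof -
  have "p * m + i < Suc p * m" using assms(2) by simp
  also have "\<dots> \<le> n * m" using assms(1) by (intro mult_le_mono1) simp
  finally show ?thesis .
qed

lemma sum_lessThan_mult:
  fixes f :: "nat \<Rightarrow> 'a::comm_monoid_add"
  shows "(\<Sum>r<n * m. f r) = (\<Sum>a<n. \<Sum>i<m. f (a * m + i))"
proof (induction n)
  case (Suc n)
  have "(\<Sum>r<k + l. f r) = (\<Sum>r<k. f r) + (\<Sum>i<l. f (k + i))" for k l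
    by (induction l) (simp_all add: add.assoc)
  from this[of "n * m" m] show ?case using Suc by (simp add: add.commute)
qed simp

text \<open>With blocks of equal size, \<open>p * m + i\<close> is row \<open>i\<close> of the \<open>p\<close>-th block row, so the
  place of a block is determined by its number alone.\<close>

lemma diag_block_mat_index:
  assumes "set As \<subseteq> carrier_mat m n" "p < length As" "q < length As" "i < m" "j < n"
  shows "diag_block_mat As $$ (p * m + i, q * n + j) = (if p = q then (As ! p) $$ (i, j) else 0)"
  using assms(1-3)
proof (induction As arbitrary: p q)
  case (Cons A As)
  have A: "dim_row A = m" "dim_col A = n" using Cons.prems by auto
  have rows: "map dim_row As = map (\<lambda>_. m) As" and cols: "map dim_col As = map (\<lambda>_. n) As"
    using Cons.prems by auto
  have D: "dim_row (diag_block_mat As) = length As * m" "dim_col (diag_block_mat As) = length As * n"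
    unfolding dim_diag_block_mat rows cols by (simp_all add: sum_list_triv)
  have bounds: "p * m + i < m + length As * m" "q * n + j < n + length As * n"
    using block_index_less[of p "Suc (length As)" i m] block_index_less[of q "Suc (length As)" j n]
      Cons.prems assms(4,5) by simp_all
  have split: "diag_block_mat (A # As) $$ (p * m + i, q * n + j) =
      (if p * m + i < m then if q * n + j < n then A $$ (p * m + i, q * n + j) else 0
       else if q * n + j < n then 0 else diag_block_mat As $$ (p * m + i - m, q * n + j - n))"
    using bounds by (auto simp: Let_def A D)
  show ?case
  proof (cases p)
    case 0
    then show ?thesis unfolding split using assms(4,5) by (cases q) auto
  next
    case p: (Suc p')
    show ?thesis
    proof (cases q)
      case 0
      then show ?thesis unfolding split using p assms(4,5) by auto
    next
      case (Suc q')
      then show ?thesis unfolding split using p Cons.IH[of p' q'] Cons.prems assms(4,5)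
        by (simp add: add.assoc)
    qed
  qed
qed simp

lemma mat_mult_index_sum:
  assumes "X \<in> carrier_mat l n" "Y \<in> carrier_mat n m" "r < l" "c < m"
  shows "(X * Y) $$ (r, c) = (\<Sum>k<n. X $$ (r, k) * Y $$ (k, c))"
  using assms by (simp add: scalar_prod_def lessThan_atLeast0)

lemma kronecker_carrier_mat:
  assumes "A \<in> carrier_mat l1 l2" "B \<in> carrier_mat m1 m2"
  shows "A \<otimes>\<^sub>K B \<in> carrier_mat (l1 * m1) (l2 * m2)"
  using assms by (simp add: kronecker_def)

text \<open>The rows of \<open>A \<otimes> I\<close> and the columns of \<open>B \<otimes> I\<close> vanish away from the inner indices \<open>i\<close>
  and \<open>j\<close>, so only the block indices are summed over.\<close>

lemma kronecker_one_sandwich_index: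
  fixes A B M :: "'a::comm_semiring_1 mat"
  assumes A: "A \<in> carrier_mat n n" and B: "B \<in> carrier_mat n n"
    and M: "M \<in> carrier_mat (n * m1) (n * m2)"
    and p: "p < n" and q: "q < n" and i: "i < m1" and j: "j < m2"
  shows "((A \<otimes>\<^sub>K 1\<^sub>m m1) * M * (B \<otimes>\<^sub>K 1\<^sub>m m2)) $$ (p * m1 + i, q * m2 + j) =
    (\<Sum>b<n. (\<Sum>a<n. A $$ (p, a) * M $$ (a * m1 + i, b * m2 + j)) * B $$ (b, q))"
proof -
  note [simp] = block_index_less
  note AI = kronecker_carrier_mat[OF A one_carrier_mat[of m1]]
    and BI = kronecker_carrier_mat[OF B one_carrier_mat[of m2]]
  have left: "((A \<otimes>\<^sub>K 1\<^sub>m m1) * M) $$ (p * m1 + i, c)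
      = (\<Sum>a<n. A $$ (p, a) * M $$ (a * m1 + i, c))" if "c < n * m2" for c
  proof -
    have "((A \<otimes>\<^sub>K 1\<^sub>m m1) * M) $$ (p * m1 + i, c)
        = (\<Sum>r<n * m1. (A \<otimes>\<^sub>K 1\<^sub>m m1) $$ (p * m1 + i, r) * M $$ (r, c))"
      by (rule mat_mult_index_sum[OF AI M _ that]) (use p i in simp)
    also have "\<dots> = (\<Sum>a<n. \<Sum>k<m1. if k = i then A $$ (p, a) * M $$ (a * m1 + i, c) else 0)"
      unfolding sum_lessThan_mult using A p i
      by (intro sum.cong) (auto simp: kronecker_def)
    finally show ?thesis using i by simp
  qed
  have "((A \<otimes>\<^sub>K 1\<^sub>m m1) * M * (B \<otimes>\<^sub>K 1\<^sub>m m2)) $$ (p * m1 + i, q * m2 + j)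
      = (\<Sum>c<n * m2. ((A \<otimes>\<^sub>K 1\<^sub>m m1) * M) $$ (p * m1 + i, c) * (B \<otimes>\<^sub>K 1\<^sub>m m2) $$ (c, q * m2 + j))"
    by (rule mat_mult_index_sum[OF mult_carrier_mat[OF AI M] BI]) (use p i q j in simp_all)
  also have "\<dots> = (\<Sum>b<n. \<Sum>k<m2. if k = j
      then ((A \<otimes>\<^sub>K 1\<^sub>m m1) * M) $$ (p * m1 + i, b * m2 + j) * B $$ (b, q) else 0)"
    unfolding sum_lessThan_mult using B q j
    by (intro sum.cong) (auto simp: kronecker_def)
  finally show ?thesis using j left by simp
qed


section \<open>Roots of unity\<close>

lemma power_mod_root_of_unity:
  fixes w :: "'a::monoid_mult"
  assumes "w ^ n = 1"
  shows "w ^ (k mod n) = w ^ k"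
proof -
  have "w ^ k = w ^ (n * (k div n) + k mod n)" by simp
  then show ?thesis unfolding power_add power_mult assms by simp
qed

text \<open>Substituting \<open>a = (l + b) mod n\<close> undoes the cyclic shift by \<open>b\<close>, and the powers of a root of
  unity do not see the reduction modulo \<open>n\<close>.\<close>

lemma sum_cyclic_shift:
  fixes w :: "'a::comm_semiring_1"
  assumes w: "w ^ n = 1" and b: "b < n"
  shows "(\<Sum>a<n. w ^ a * h (nat ((int a - int b) mod int n))) = w ^ b * (\<Sum>l<n. w ^ l * h l)"
proof -
  have unshift: "nat ((int ((l + b) mod n) - int b) mod int n) = l" if "l < n" for l
    using that by (simp add: zmod_int mod_diff_left_eq)
  have shift: "(nat ((int a - int b) mod int n) + b) mod n = a" if "a < n" for a
  proof -
    have "int ((nat ((int a - int b) mod int n) + b) mod n) = ((int a - int b) mod int n + int b) mod int n"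
      using b by (simp add: zmod_int)
    also have "\<dots> = int a" using that by (simp add: mod_add_left_eq)
    finally show ?thesis by linarith
  qed
  have bound: "nat ((int a - int b) mod int n) < n" for a
    using b by (simp add: nat_less_iff)
  have "(\<Sum>a<n. w ^ a * h (nat ((int a - int b) mod int n))) = (\<Sum>l<n. w ^ b * (w ^ l * h l))"
  proof (rule sum.reindex_bij_witness[where i = "\<lambda>l. (l + b) mod n"
        and j = "\<lambda>a. nat ((int a - int b) mod int n)"])
    fix a assume "a \<in> {..<n}"
    then have "w ^ a = w ^ ((nat ((int a - int b) mod int n) + b) mod n)"
      by (simp only: shift lessThan_iff)
    then have "w ^ a = w ^ (nat ((int a - int b) mod int n) + b)"
      by (simp only: power_mod_root_of_unity[OF w])
    then show "w ^ b * (w ^ nat ((int a - int b) mod int n) * h (nat ((int a - int b) mod int n)))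
        = w ^ a * h (nat ((int a - int b) mod int n))"
      by (simp add: power_add ac_simps)
  qed (use b bound shift unshift in auto)
  then show ?thesis by (simp add: sum_distrib_left)
qed

definition dft_root :: "nat \<Rightarrow> complex" where
  "dft_root n = exp (- (2 * of_real pi * \<i>) / of_nat n)"

lemma dft_mat_eq:
  "dft_mat n = mat n n (\<lambda>(p, q). 1 / complex_of_real (sqrt (real n)) * dft_root n ^ (p * q))"
  by (simp only: dft_mat_def dft_root_def)

text \<open>Writing the powers as conjugates of the standard roots of unity \<open>exp (2 \<pi> \<i> k / n)\<close> gives
  access to the criterion for when two of these coincide.\<close>

lemma dft_root_power: "dft_root n ^ k = cnj (exp (2 * of_real pi * \<i> * of_nat k / of_nat n))"
  by (simp add: dft_root_def exp_of_nat_mult[symmetric] exp_cnj field_simps)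

lemma dft_root_power_self: "0 < n \<Longrightarrow> dft_root n ^ n = 1"
  by (subst dft_root_power) simp

lemma dft_root_power_mult_cnj: "dft_root n ^ k * cnj (dft_root n ^ k) = 1"
  unfolding dft_root_power exp_cnj exp_add[symmetric] by simp

text \<open>For \<open>p \<noteq> q\<close> the summands are the powers of \<open>z = \<omega>\<^sup>p * cnj \<omega>\<^sup>q\<close>, an \<open>n\<close>-th root of unity other
  than \<open>1\<close>, so the geometric sum vanishes; for \<open>p = q\<close> they are all \<open>1\<close>.\<close>

lemma dft_rows_orthogonal:
  assumes "p < n" "q < n"
  shows "(\<Sum>b<n. dft_root n ^ (p * b) * cnj (dft_root n ^ (q * b))) = (if p = q then of_nat n else 0)"
proof (cases "p = q")
  case True
  then show ?thesis by (simp only: dft_root_power_mult_cnj) simp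
next
  case False
  define z where "z = dft_root n ^ p * cnj (dft_root n ^ q)"
  have "dft_root n ^ p \<noteq> dft_root n ^ q"
    using complex_root_unity_eq[of n p q] False assms by (simp add: dft_root_power)
  then have "z \<noteq> 1"
    using dft_root_power_mult_cnj[of n q] by (metis z_def mult_right_cancel mult_zero_right zero_neq_one)
  moreover have root: "(dft_root n ^ k) ^ n = 1" for k
    using assms by (simp only: power_mult[symmetric] mult.commute[of k])
      (simp only: power_mult dft_root_power_self[of n], simp)
  have "z ^ n = 1"
    unfolding z_def power_mult_distrib complex_cnj_power[symmetric] root by simp
  moreover have "(\<Sum>b<n. dft_root n ^ (p * b) * cnj (dft_root n ^ (q * b))) = (\<Sum>b<n. z ^ b)"
    by (simp add: z_def power_mult power_mult_distrib)
  ultimately show ?thesis using False by (simp add: geometric_sum)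
qed


section \<open>The Fourier blocks of a tensor\<close>

text \<open>The \<open>k\<close>-th matrix in the list is the \<open>k\<close>-th frontal slice of the tensor obtained from \<open>T\<close> by
  the unnormalized transform along the third index.\<close>

definition tube_dft :: "nat \<Rightarrow> nat \<Rightarrow> nat \<Rightarrow> real tensor3 \<Rightarrow> complex mat list" where
  "tube_dft n1 n2 n3 T =
     map (\<lambda>k. mat n1 n2 (\<lambda>(i, j). \<Sum>l<n3. dft_root n3 ^ (k * l) * of_real (T i j l))) [0..<n3]"

text \<open>Inside the sandwich, \<open>row\<close> evaluates the product of row \<open>p\<close> of \<open>F\<close> with column \<open>b\<close> of a
  scalar circulant matrix: up to normalization it is \<open>\<omega>\<^sup>p\<^sup>b\<close> times an eigenvalue independent of \<open>b\<close>,
  that is, the rows of \<open>F\<close> are left eigenvectors. Orthogonality of the rows of \<open>F\<close> then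
  annihilates the off-diagonal blocks. The two normalizations \<open>1 / sqrt n3\<close> cancel the factor \<open>n3\<close>
  from the orthogonality relation, leaving the eigenvalue itself, which is unnormalized.\<close>

lemma dft_conjugated_bcirc_index:
  assumes p: "p < n3" and q: "q < n3" and i: "i < n1" and j: "j < n2"
  shows "((dft_mat n3 \<otimes>\<^sub>K 1\<^sub>m n1) * map_mat complex_of_real (bcirc n1 n2 n3 T)
       * (mat_adjoint (dft_mat n3) \<otimes>\<^sub>K 1\<^sub>m n2)) $$ (p * n1 + i, q * n2 + j)
    = (if p = q then \<Sum>l<n3. dft_root n3 ^ (p * l) * of_real (T i j l) else 0)"
proof -
  let ?w = "dft_root n3"
  let ?c = "1 / complex_of_real (sqrt (real n3))"
  let ?M = "map_mat complex_of_real (bcirc n1 n2 n3 T)"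
  let ?t = "\<lambda>l. complex_of_real (T i j l)"
  have F: "dft_mat n3 $$ (x, y) = ?c * ?w ^ (x * y)" if "x < n3" "y < n3" for x y
    using that by (simp add: dft_mat_eq)
  have FH: "mat_adjoint (dft_mat n3) $$ (x, y) = ?c * cnj (?w ^ (y * x))" if "x < n3" "y < n3" for x y
    using that by (simp add: mat_adjoint_def mat_of_rows_def dft_mat_eq)
  have M: "?M $$ (a * n1 + i, b * n2 + j) = ?t (nat ((int a - int b) mod int n3))"
    if "a < n3" "b < n3" for a b
    using that i j block_index_less[of a n3 i n1] block_index_less[of b n3 j n2]
    by (simp add: bcirc_def mult.commute)
  have "(?w ^ p) ^ n3 = (?w ^ n3) ^ p" by (simp only: power_mult[symmetric] mult.commute)
  then have wp: "(?w ^ p) ^ n3 = 1" using p by (simp only: dft_root_power_self) simp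
  have row: "(\<Sum>a<n3. dft_mat n3 $$ (p, a) * ?M $$ (a * n1 + i, b * n2 + j))
      = ?c * (?w ^ (p * b) * (\<Sum>l<n3. ?w ^ (p * l) * ?t l))" if "b < n3" for b
  proof -
    have "(\<Sum>a<n3. dft_mat n3 $$ (p, a) * ?M $$ (a * n1 + i, b * n2 + j))
        = ?c * (\<Sum>a<n3. (?w ^ p) ^ a * ?t (nat ((int a - int b) mod int n3)))"
      unfolding sum_distrib_left
      by (intro sum.cong refl) (use p that in \<open>simp add: F M power_mult\<close>)
    also have "\<dots> = ?c * ((?w ^ p) ^ b * (\<Sum>l<n3. (?w ^ p) ^ l * ?t l))"
      by (simp only: sum_cyclic_shift[OF wp that, where h = ?t])
    finally show ?thesis by (simp only: power_mult)
  qed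
  have "((dft_mat n3 \<otimes>\<^sub>K 1\<^sub>m n1) * ?M * (mat_adjoint (dft_mat n3) \<otimes>\<^sub>K 1\<^sub>m n2)) $$ (p * n1 + i, q * n2 + j)
      = (\<Sum>b<n3. (\<Sum>a<n3. dft_mat n3 $$ (p, a) * ?M $$ (a * n1 + i, b * n2 + j))
          * mat_adjoint (dft_mat n3) $$ (b, q))"
    by (rule kronecker_one_sandwich_index)
      (use p q i j in \<open>auto simp: dft_mat_def mat_adjoint_def bcirc_def mult.commute\<close>)
  also have "\<dots> = (\<Sum>b<n3. ?c * (?w ^ (p * b) * (\<Sum>l<n3. ?w ^ (p * l) * ?t l)) * (?c * cnj (?w ^ (q * b))))"
    by (intro sum.cong refl) (use q in \<open>simp only: row FH lessThan_iff\<close>)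
  also have "\<dots> = (?c * ?c) * (\<Sum>l<n3. ?w ^ (p * l) * ?t l) * (\<Sum>b<n3. ?w ^ (p * b) * cnj (?w ^ (q * b)))"
    unfolding sum_distrib_left[where A = "{..<n3}" and f = "\<lambda>b. ?w ^ (p * b) * cnj (?w ^ (q * b))"]
    by (intro sum.cong refl) (simp only: mult_ac)
  also have "\<dots> = (?c * ?c) * (\<Sum>l<n3. ?w ^ (p * l) * ?t l) * (if p = q then of_nat n3 else 0)"
    by (simp only: dft_rows_orthogonal[OF p q])
  also have "?c * ?c = 1 / of_nat n3"
    by (simp add: of_real_mult[symmetric] del: of_real_mult)
  finally show ?thesis using p by simp
qed

lemma is_fourier_blocks_tube_dft: "is_fourier_blocks n1 n2 n3 T (tube_dft n1 n2 n3 T)"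
  unfolding is_fourier_blocks_def
proof (intro conjI)
  let ?L = "(dft_mat n3 \<otimes>\<^sub>K 1\<^sub>m n1) * map_mat complex_of_real (bcirc n1 n2 n3 T)
       * (mat_adjoint (dft_mat n3) \<otimes>\<^sub>K 1\<^sub>m n2)"
  show len: "length (tube_dft n1 n2 n3 T) = n3" by (simp add: tube_dft_def)
  show car: "set (tube_dft n1 n2 n3 T) \<subseteq> carrier_mat n1 n2" by (auto simp: tube_dft_def)
  have dims: "dim_row (diag_block_mat (tube_dft n1 n2 n3 T)) = n3 * n1"
    "dim_col (diag_block_mat (tube_dft n1 n2 n3 T)) = n3 * n2"
    by (simp_all add: dim_diag_block_mat tube_dft_def comp_def sum_list_triv)
  show "?L = diag_block_mat (tube_dft n1 n2 n3 T)"
  proof (rule eq_matI)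
    fix r c
    assume "r < dim_row (diag_block_mat (tube_dft n1 n2 n3 T))"
      and "c < dim_col (diag_block_mat (tube_dft n1 n2 n3 T))"
    then have r: "r < n3 * n1" and c: "c < n3 * n2" by (simp_all add: dims)
    then have "0 < n1" "0 < n2" by (auto intro: gr0I)
    with r c have bounds: "r div n1 < n3" "c div n2 < n3" "r mod n1 < n1" "c mod n2 < n2"
      by (simp_all add: less_mult_imp_div_less)
    have "?L $$ (r div n1 * n1 + r mod n1, c div n2 * n2 + c mod n2)
        = diag_block_mat (tube_dft n1 n2 n3 T) $$ (r div n1 * n1 + r mod n1, c div n2 * n2 + c mod n2)"
      unfolding dft_conjugated_bcirc_index[OF bounds]
      using diag_block_mat_index[OF car, unfolded len, OF bounds] bounds
      by (simp add: tube_dft_def)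
    then show "?L $$ (r, c) = diag_block_mat (tube_dft n1 n2 n3 T) $$ (r, c)" by simp
  qed (simp_all only: dims, simp_all add: kronecker_def dft_mat_def mat_adjoint_def)
qed

text \<open>The description of the Fourier blocks by \<^const>\<open>is_fourier_blocks\<close> is unique because the size
  and number of the blocks are prescribed, so that equal block diagonal matrices
  have equal blocks.\<close>

lemma fourier_blocks_eq_tube_dft: "fourier_blocks n1 n2 n3 T = tube_dft n1 n2 n3 T"
  unfolding fourier_blocks_def
proof (rule the_equality, rule is_fourier_blocks_tube_dft)
  fix Ts assume "is_fourier_blocks n1 n2 n3 T Ts"
  then have len: "length Ts = n3" and car: "set Ts \<subseteq> carrier_mat n1 n2"
    and eq: "diag_block_mat Ts = diag_block_mat (tube_dft n1 n2 n3 T)"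
    using is_fourier_blocks_tube_dft[of n1 n2 n3 T] by (simp_all add: is_fourier_blocks_def)
  have len': "length (tube_dft n1 n2 n3 T) = n3"
    and car': "set (tube_dft n1 n2 n3 T) \<subseteq> carrier_mat n1 n2"
    using is_fourier_blocks_tube_dft[of n1 n2 n3 T] by (simp_all add: is_fourier_blocks_def)
  show "Ts = tube_dft n1 n2 n3 T"
  proof (rule nth_equalityI)
    fix k assume "k < length Ts"
    then have k: "k < n3" by (simp add: len)
    have "Ts ! k \<in> carrier_mat n1 n2" "tube_dft n1 n2 n3 T ! k \<in> carrier_mat n1 n2"
      by (rule subsetD[OF car], rule nth_mem, simp add: k len)
        (rule subsetD[OF car'], rule nth_mem, simp add: k len')
    moreover have "(Ts ! k) $$ (i, j) = (tube_dft n1 n2 n3 T ! k) $$ (i, j)" if "i < n1" "j < n2" for i j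
      using diag_block_mat_index[OF car, unfolded len, OF k k that]
        diag_block_mat_index[OF car', unfolded len', OF k k that] by (simp add: eq)
    ultimately show "Ts ! k = tube_dft n1 n2 n3 T ! k" by (intro eq_matI) auto
  qed (simp add: len len')
qed

text \<open>The factor \<open>sqrt n\<close> turns the unitary transform into the unnormalized one.\<close>

lemma mode2_prod_dft_mat:
  assumes "k < n"
  shows "complex_of_real (sqrt (real n)) * (complex_tensor G \<times>\<^sub>2 dft_mat n) a k b
    = (\<Sum>l<n. dft_root n ^ (k * l) * of_real (G a l b))"
proof -
  have "complex_of_real (sqrt (real n)) \<noteq> 0" using assms by simp
  then show ?thesis using assms
    by (simp add: mode2_prod_def complex_tensor_def dft_mat_eq sum_distrib_left)
qed

theorem proposition3p1:
  fixes n1 n2 n3 r1 r2 :: nat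
    and T G1 G2 G3 :: "real tensor3"
  assumes "is_ttd n1 n2 n3 r1 r2 T G1 G2 G3"
    and "j1 < n1" and "j2 < n2" and "j3 < n3"
  shows "(fourier_blocks n1 n2 n3 T ! j3) $$ (j1, j2) =
    complex_of_real (sqrt (real n3)) *
      (\<Sum>\<alpha>1<r1. \<Sum>\<alpha>2<r2. complex_of_real (G1 0 j1 \<alpha>1) * complex_of_real (G2 \<alpha>1 j2 \<alpha>2)
         * (complex_tensor G3 \<times>\<^sub>2 dft_mat n3) \<alpha>2 j3 0)"
proof -
  let ?w = "dft_root n3"
  let ?g = "\<lambda>\<alpha>1 \<alpha>2. complex_of_real (G1 0 j1 \<alpha>1) * complex_of_real (G2 \<alpha>1 j2 \<alpha>2)"
  have "(fourier_blocks n1 n2 n3 T ! j3) $$ (j1, j2) = (\<Sum>l<n3. ?w ^ (j3 * l) * of_real (T j1 j2 l))"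
    using assms(2-4) by (simp add: fourier_blocks_eq_tube_dft tube_dft_def)
  also have "\<dots> = (\<Sum>l<n3. \<Sum>\<alpha>1<r1. \<Sum>\<alpha>2<r2. ?g \<alpha>1 \<alpha>2 * (?w ^ (j3 * l) * of_real (G3 \<alpha>2 l 0)))"
  proof (intro sum.cong refl)
    fix l assume "l \<in> {..<n3}"
    then have "T j1 j2 l = (\<Sum>\<alpha>1<r1. \<Sum>\<alpha>2<r2. G1 0 j1 \<alpha>1 * G2 \<alpha>1 j2 \<alpha>2 * G3 \<alpha>2 l 0)"
      using assms(1-3) by (simp add: is_ttd_def)
    then show "?w ^ (j3 * l) * of_real (T j1 j2 l)
        = (\<Sum>\<alpha>1<r1. \<Sum>\<alpha>2<r2. ?g \<alpha>1 \<alpha>2 * (?w ^ (j3 * l) * of_real (G3 \<alpha>2 l 0)))"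
      by (simp add: sum_distrib_left mult_ac)
  qed
  also have "\<dots> = (\<Sum>\<alpha>1<r1. \<Sum>\<alpha>2<r2. ?g \<alpha>1 \<alpha>2 * (\<Sum>l<n3. ?w ^ (j3 * l) * of_real (G3 \<alpha>2 l 0)))"
    unfolding sum_distrib_left by (subst sum.swap) (intro sum.cong refl sum.swap)
  also have "\<dots> = (\<Sum>\<alpha>1<r1. \<Sum>\<alpha>2<r2. ?g \<alpha>1 \<alpha>2 *
      (complex_of_real (sqrt (real n3)) * (complex_tensor G3 \<times>\<^sub>2 dft_mat n3) \<alpha>2 j3 0))"
    by (simp only: mode2_prod_dft_mat[OF assms(4)])
  finally show ?thesis by (simp add: sum_distrib_left mult_ac)
qed

end
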